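(* Assume projective determinacy (for games over the reals). Then every projective semiselective coideal $\mathcal{H}\subseteq\wp(\mathbb{N})$ has the Fréchet–Urysohn property.
   Context: $\wp(\mathbb{N})$ is identified with the Cantor space $2^{\mathbb{N}}$ for the notion "projective". $A^{[\infty]}$ is the set of infinite subsets of $A$; $A/n=\{m\in A:m>n\}$. A coideal is $\mathcal{H}\subseteq\wp(\mathbb{N})$, $\mathcal{H}\neq\wp(\mathbb{N})$, upward closed and with $A\cup B\in\mathcal{H}\Rightarrow A\in\mathcal{H}$ or $B\in\mathcal{H}$. $D\subseteq\mathcal{H}$ is dense open in $(\mathcal{H},\subseteq)$ if every element of $\mathcal{H}$ has a subset in $D$ and $D$ is closed under subsets lying in $\mathcal{H}$. $\mathcal{H}$ is semiselective if for every sequence $(D_n)_n$ of dense open subsets of $(\mathcal{H},\subseteq)$ and every $A\in\mathcal{H}$ there is $B\in\mathcal{H}$, $B\subseteq A$, with $B/n\in D_n$ for all $n\in B$. $\mathcal{H}$ has the Fréchet–Urysohn property if for every $A\in\mathcal{H}$ there is $B\in A^{[\infty]}$ with $B^{[\infty]}\subseteq\mathcal{H}$. *)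

theory Defs
  imports "HOL-Analysis.Analysis"
begin

text \<open>
  The projective hierarchy of a Polish space \<open>X\<close>: a set is \<open>\<Sigma>\<^sup>1\<^sub>1\<close> if it is the projection of
  a Borel subset of \<open>X \<times> \<N>\<close>, where \<open>\<N>\<close> is the Baire space, and \<open>\<Sigma>\<^sup>1\<^sub>n\<^sub>+\<^sub>1\<close> if it is the projection
  of the complement of a \<open>\<Sigma>\<^sup>1\<^sub>n\<close> subset of \<open>X \<times> \<N>\<close>.  Since the ambient space changes from one
  level to the next, all sets are viewed as subsets of \<open>X \<times> \<N> \<times> \<N> \<times> \<dots>\<close>, and step \<open>n\<close>
  projects along coordinate number \<open>n\<close> of the sequence of parameters.  A subset \<open>A\<close> of \<open>X\<close> is
  identified with the cylinder over it.  (As sections of Borel sets are Borel, it does no harm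
  that the Borel set at the bottom may depend on all the parameters.)
\<close>

primrec Sigma1 ::
  "nat \<Rightarrow> ('a::topological_space \<times> (nat \<Rightarrow> nat \<Rightarrow> nat)) set set" where
  "Sigma1 0 = sets borel"
| "Sigma1 (Suc n) = {{(x, y). \<exists>z. (x, y(n := z)) \<in> - B} | B. B \<in> Sigma1 n}"

definition projective :: "'a::topological_space set \<Rightarrow> bool" where
  "projective A \<longleftrightarrow> (\<exists>n. A \<times> UNIV \<in> Sigma1 n)"

text \<open>Subsets of \<open>\<nat>\<close> are identified with their characteristic functions in the Cantor space.\<close>

definition projective_family :: "nat set set \<Rightarrow> bool" where
  "projective_family H \<longleftrightarrow> projective ((\<lambda>A. (\<lambda>n. n \<in> A) :: nat \<Rightarrow> bool) ` H)"

text \<open>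
  The game of length \<open>\<omega>\<close> with moves of type \<open>'m\<close> and payoff \<open>W\<close>: player I chooses the even and
  player II the odd entries of the run \<open>x\<close>, and player I wins iff \<open>x \<in> W\<close>.  A strategy assigns a
  move to each list of previous moves of both players.
\<close>

definition follows_I :: "('m list \<Rightarrow> 'm) \<Rightarrow> (nat \<Rightarrow> 'm) \<Rightarrow> bool" where
  "follows_I \<sigma> x \<longleftrightarrow> (\<forall>k. x (2 * k) = \<sigma> (map x [0..<2 * k]))"

definition follows_II :: "('m list \<Rightarrow> 'm) \<Rightarrow> (nat \<Rightarrow> 'm) \<Rightarrow> bool" where
  "follows_II \<tau> x \<longleftrightarrow> (\<forall>k. x (2 * k + 1) = \<tau> (map x [0..<2 * k + 1]))"

definition determined :: "(nat \<Rightarrow> 'm) set \<Rightarrow> bool" where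
  "determined W \<longleftrightarrow>
     (\<exists>\<sigma>. \<forall>x. follows_I \<sigma> x \<longrightarrow> x \<in> W) \<or> (\<exists>\<tau>. \<forall>x. follows_II \<tau> x \<longrightarrow> x \<notin> W)"

text \<open>
  Here the topology on runs is the product topology of countably many copies of the real line
  with its usual (not the discrete) topology.
\<close>

definition projective_determinacy_reals :: bool where
  "projective_determinacy_reals \<longleftrightarrow> (\<forall>W :: (nat \<Rightarrow> real) set. projective W \<longrightarrow> determined W)"

definition coideal :: "nat set set \<Rightarrow> bool" where
  "coideal H \<longleftrightarrow> H \<noteq> UNIV \<and> (\<forall>A B. A \<in> H \<and> A \<subseteq> B \<longrightarrow> B \<in> H) \<and>
     (\<forall>A B. A \<union> B \<in> H \<longrightarrow> A \<in> H \<or> B \<in> H)"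

definition dense_open :: "nat set set \<Rightarrow> nat set set \<Rightarrow> bool" where
  "dense_open H D \<longleftrightarrow> D \<subseteq> H \<and> (\<forall>A\<in>H. \<exists>B\<in>D. B \<subseteq> A) \<and>
     (\<forall>A\<in>D. \<forall>B\<in>H. B \<subseteq> A \<longrightarrow> B \<in> D)"

definition semiselective :: "nat set set \<Rightarrow> bool" where
  "semiselective H \<longleftrightarrow> (\<forall>D :: nat \<Rightarrow> nat set set. (\<forall>n. dense_open H (D n)) \<longrightarrow>
     (\<forall>A\<in>H. \<exists>B\<in>H. B \<subseteq> A \<and> (\<forall>n\<in>B. {m\<in>B. m > n} \<in> D n)))"

definition frechet_urysohn :: "nat set set \<Rightarrow> bool" where
  "frechet_urysohn H \<longleftrightarrow>
     (\<forall>A\<in>H. \<exists>B. B \<subseteq> A \<and> infinite B \<and> (\<forall>C. C \<subseteq> B \<and> infinite C \<longrightarrow> C \<in> H))"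

end

theory Submission
  imports Defs
begin

text \<open>
  Play the Kastanas game below \<open>A \<in> H\<close>: I plays \<open>a\<^sub>k \<in> H\<close>, II answers with \<open>c\<^sub>k \<in> H\<close>, \<open>c\<^sub>k \<subseteq> a\<^sub>k\<close>, and
  \<open>a\<^sub>k\<^sub>+\<^sub>1 \<subseteq> c\<^sub>k - {min c\<^sub>k}\<close>; I wins iff the outcome \<open>{min c\<^sub>k | k}\<close> lies in \<open>H\<close>.  Coding subsets of \<open>\<nat>\<close>
  by reals makes this a projective game.  If I wins, a fusion over the finite subsets of a growing set
  produces \<open>B \<subseteq> A\<close> all of whose infinite subsets are outcomes of runs won by I.  II cannot win: by
  semiselectivity, applied once to make the possible answers of II cohere and once to diagonalize the
  resulting tree, some element of \<open>H\<close> is itself the outcome of a run following II's strategy.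
\<close>

subsection \<open>Projective predicates\<close>

text \<open>Characteristic functions have type \<open>nat \<Rightarrow> bool\<close>. Second
  countability of \<open>bool\<close> passes to this Cantor space and lets Borel measurability of
  maps into it be checked coordinatewise.\<close>

instance bool :: second_countable_topology
proof
  show "\<exists>B :: bool set set. countable B \<and> open = generate_topology B"
    by (intro exI[of _ "range lessThan \<union> range greaterThan"]) (auto simp: open_bool_def)
qed

section \<open>Closure properties of the levels of the hierarchy\<close>

lemma Sigma1_SucI: "C \<in> Sigma1 n \<Longrightarrow> {(x, y). \<exists>z. (x, y(n := z)) \<notin> C} \<in> Sigma1 (Suc n)"
  by auto

lemma Sigma1_SucE:
  assumes "B \<in> Sigma1 (Suc n)"
  obtains C where "C \<in> Sigma1 n" "B = {(x, y). \<exists>z. (x, y(n := z)) \<notin> C}"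
  using assms by auto

declare Sigma1.simps(2) [simp del]

lemma Sigma1_vimage:
  fixes f :: "'a::second_countable_topology \<Rightarrow> 'b::second_countable_topology"
  assumes f: "f \<in> borel_measurable borel"
  shows "B \<in> Sigma1 n \<Longrightarrow> {(x, y). (f x, y) \<in> B} \<in> Sigma1 n"
proof (induction n arbitrary: B)
  case 0
  have "(\<lambda>p. (f (fst p), snd p)) \<in> borel_measurable
      (borel :: ('a \<times> (nat \<Rightarrow> nat \<Rightarrow> nat)) measure)"
    by (intro borel_measurable_Pair measurable_compose[OF _ f] borel_measurable_continuous_onI
        continuous_intros)
  from measurable_sets[OF this, of B] 0 show ?case
    by (simp add: vimage_def case_prod_unfold)
next
  case (Suc n)
  obtain C where C: "C \<in> Sigma1 n" "B = {(x, y). \<exists>z. (x, y(n := z)) \<notin> C}"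
    using Sigma1_SucE[OF Suc.prems] .
  have "{(x, y). (f x, y) \<in> B} = {(x, y). \<exists>z. (x, y(n := z)) \<notin> {(x, y). (f x, y) \<in> C}}"
    by (auto simp: C(2))
  with Sigma1_SucI[OF Suc.IH[OF C(1)]] show ?case by (simp only: Sigma1.simps(1))
qed

text \<open>Renumbering the parameters moves every projection one coordinate up and frees coordinate
  0. At the bottom a Borel set is then projected vacuously along that coordinate, which raises the
  level by one.\<close>

lemma Sigma1_shift:
  fixes B :: "('a::second_countable_topology \<times> (nat \<Rightarrow> nat \<Rightarrow> nat)) set"
  shows "B \<in> Sigma1 n \<Longrightarrow> {(x, y). (x, \<lambda>i. y (Suc i)) \<in> B} \<in> Sigma1 (Suc n)"
proof (induction n arbitrary: B)
  case 0
  let ?C = "{(x, y). (x, \<lambda>i. y (Suc i)) \<in> B}"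
  have "(\<lambda>p. (fst p, \<lambda>i. snd p (Suc i))) \<in> borel_measurable
      (borel :: ('a \<times> (nat \<Rightarrow> nat \<Rightarrow> nat)) measure)"
    by (intro borel_measurable_continuous_onI continuous_on_Pair
        continuous_on_fst continuous_on_id continuous_on_coordinatewise_then_product
        continuous_on_product_then_coordinatewise[OF continuous_on_snd[OF continuous_on_id]])
  from measurable_sets[OF this, of B] 0 have "?C \<in> sets borel"
    by (simp add: vimage_def case_prod_unfold)
  then have "- ?C \<in> Sigma1 0" by auto
  moreover have "?C = {(x, y). \<exists>z. (x, y(0 := z)) \<notin> - ?C}" by auto
  ultimately show ?case using Sigma1_SucI[of "- ?C" 0] by (simp only:)
next
  case (Suc n)
  obtain C where C: "C \<in> Sigma1 n" "B = {(x, y). \<exists>z. (x, y(n := z)) \<notin> C}"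
    using Sigma1_SucE[OF Suc.prems] .
  have eq: "(\<lambda>i. y (Suc i))(n := z) = (\<lambda>i. (y(Suc n := z)) (Suc i))"
    for y :: "nat \<Rightarrow> nat \<Rightarrow> nat" and z
    by auto
  have "{(x, y). (x, \<lambda>i. y (Suc i)) \<in> B} =
      {(x, y). \<exists>z. (x, y(Suc n := z)) \<notin> {(x, y). (x, \<lambda>i. y (Suc i)) \<in> C}}"
    unfolding C(2) mem_Collect_eq case_prod_conv eq by simp
  with Sigma1_SucI[OF Suc.IH[OF C(1)]] show ?case by (simp only: Sigma1.simps(1))
qed

text \<open>Level \<open>n\<close> projects only along coordinates below \<open>n\<close>, so
  \<open>y m\<close> passes through all projections unchanged and its value at 0 can select the set.
  A later projection along coordinate \<open>m\<close> turns this selector into a quantifier over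
  the natural numbers.\<close>

lemma Sigma1_join:
  fixes B :: "nat \<Rightarrow> ('a::second_countable_topology \<times> (nat \<Rightarrow> nat \<Rightarrow> nat)) set"
  assumes "n \<le> m"
  shows "(\<And>i. B i \<in> Sigma1 n) \<Longrightarrow> {(x, y). (x, y) \<in> B (y m 0)} \<in> Sigma1 n"
  using assms
proof (induction n arbitrary: B)
  case 0
  have "(\<lambda>p. snd p m 0) \<in> borel_measurable
      (borel :: ('a \<times> (nat \<Rightarrow> nat \<Rightarrow> nat)) measure)"
    by (intro borel_measurable_continuous_onI) (rule continuous_on_product_then_coordinatewise[OF
        continuous_on_product_then_coordinatewise[OF continuous_on_snd[OF continuous_on_id]]])
  from measurable_sets[OF this, of "{i}" for i]
  have "{p :: 'a \<times> (nat \<Rightarrow> nat \<Rightarrow> nat). snd p m 0 = i} \<in> sets borel" for i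
    by (simp add: vimage_def)
  then have "(\<Union>i. B i \<inter> {p. snd p m 0 = i}) \<in> sets borel"
    using 0(1) by (intro sets.countable_UN sets.Int) auto
  moreover have "{(x, y). (x, y) \<in> B (y m 0)} = (\<Union>i. B i \<inter> {p. snd p m 0 = i})"
    by auto
  ultimately show ?case by (simp only: Sigma1.simps(1))
next
  case (Suc n)
  have "\<exists>C. C \<in> Sigma1 n \<and> B i = {(x, y). \<exists>z. (x, y(n := z)) \<notin> C}" for i
    by (rule Sigma1_SucE[OF Suc.prems(1)[of i]]) blast
  then have "\<exists>C. \<forall>i. C i \<in> Sigma1 n \<and> B i = {(x, y). \<exists>z. (x, y(n := z)) \<notin> C i}"
    by (intro choice allI)
  then obtain C where C: "\<And>i. C i \<in> Sigma1 n"
      "\<And>i. B i = {(x, y). \<exists>z. (x, y(n := z)) \<notin> C i}"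
    by blast
  have "{(x, y). (x, y) \<in> B (y m 0)} =
      {(x, y). \<exists>z. (x, y(n := z)) \<notin> {(x, y). (x, y) \<in> C (y m 0)}}"
    using Suc.prems(2) by (auto simp: C(2))
  moreover have "{(x, y). (x, y) \<in> C (y m 0)} \<in> Sigma1 n"
    using C(1) Suc.prems(2) by (intro Suc.IH) auto
  ultimately show ?case using Sigma1_SucI by (simp only:)
qed

section \<open>A calculus of projective predicates\<close>

definition Sigma1_pred :: "nat \<Rightarrow> ('a::topological_space \<Rightarrow> bool) \<Rightarrow> bool" where
  "Sigma1_pred n P \<longleftrightarrow> {x. P x} \<times> UNIV \<in> Sigma1 n"

lemma Sigma1_pred_Suc:
  fixes P :: "'a::second_countable_topology \<Rightarrow> bool"
  assumes "Sigma1_pred n P"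
  shows "Sigma1_pred (Suc n) P"
proof -
  have "{(x, y). (x, \<lambda>i. y (Suc i)) \<in> {x. P x} \<times> UNIV} = {x. P x} \<times> (UNIV :: (nat \<Rightarrow> nat \<Rightarrow> nat) set)"
    by auto
  with Sigma1_shift[OF assms[unfolded Sigma1_pred_def]] show ?thesis
    unfolding Sigma1_pred_def by metis
qed

lemma Sigma1_pred_mono:
  fixes P :: "'a::second_countable_topology \<Rightarrow> bool"
  assumes "Sigma1_pred n P" "n \<le> m"
  shows "Sigma1_pred m P"
  using assms(2,1) by (induction rule: dec_induct) (auto intro: Sigma1_pred_Suc)

lemma Sigma1_pred_borel:
  fixes P :: "'a::second_countable_topology \<Rightarrow> bool"
  assumes "Measurable.pred borel P"
  shows "Sigma1_pred n P"
proof -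
  have "{x. P x} \<times> UNIV \<in> sets (borel \<Otimes>\<^sub>M (borel :: (nat \<Rightarrow> nat \<Rightarrow> nat) measure))"
    using assms by (intro pair_measureI) (auto simp: pred_def)
  then have "Sigma1_pred 0 P"
    unfolding Sigma1_pred_def Sigma1.simps(1) borel_prod .
  then show ?thesis by (rule Sigma1_pred_mono) simp
qed

lemma Sigma1_pred_compose:
  fixes P :: "'b::second_countable_topology \<Rightarrow> bool"
    and f :: "'a::second_countable_topology \<Rightarrow> 'b"
  assumes "f \<in> borel_measurable borel" "Sigma1_pred n P"
  shows "Sigma1_pred n (\<lambda>x. P (f x))"
proof -
  have "{(x, y). (f x, y) \<in> {x. P x} \<times> UNIV} = {x. P (f x)} \<times> (UNIV :: (nat \<Rightarrow> nat \<Rightarrow> nat) set)"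
    by auto
  with Sigma1_vimage[OF assms(1) assms(2)[unfolded Sigma1_pred_def]] show ?thesis
    unfolding Sigma1_pred_def by metis
qed

text \<open>A single projection of a complement yields a negation and a countable disjunction at
  once, the witness \<open>z\<close> entering only through \<open>z 0\<close>. The other connectives
  are derived from this one with generous levels, because only being projective at some level counts
  in the end.\<close>

lemma Sigma1_pred_not_all:
  fixes P :: "nat \<Rightarrow> 'a::second_countable_topology \<Rightarrow> bool"
  assumes "\<And>i. Sigma1_pred n (P i)"
  shows "Sigma1_pred (Suc n) (\<lambda>x. \<not> (\<forall>i. P i x))"
proof -
  let ?B = "{(x, y). (x, y) \<in> {x. P (y n 0) x} \<times> (UNIV :: (nat \<Rightarrow> nat \<Rightarrow> nat) set)}"
  have "?B \<in> Sigma1 n"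
    using Sigma1_join[of n n "\<lambda>i. {x. P i x} \<times> UNIV"] assms by (simp add: Sigma1_pred_def)
  moreover have "{x. \<not> (\<forall>i. P i x)} \<times> UNIV = {(x, y). \<exists>z. (x, y(n := z)) \<notin> ?B}"
  proof -
    have "(\<exists>z :: nat \<Rightarrow> nat. \<not> P (z 0) x) \<longleftrightarrow> \<not> (\<forall>i. P i x)" for x
      by (auto intro: exI[of _ "\<lambda>_. _"])
    then show ?thesis by auto
  qed
  ultimately show ?thesis unfolding Sigma1_pred_def using Sigma1_SucI[of ?B n] by (simp only:)
qed

lemma Sigma1_pred_not:
  fixes P :: "'a::second_countable_topology \<Rightarrow> bool"
  assumes "Sigma1_pred n P"
  shows "Sigma1_pred (Suc n) (\<lambda>x. \<not> P x)"
  using Sigma1_pred_not_all[of n "\<lambda>_. P"] assms by simp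

lemma Sigma1_pred_all:
  fixes P :: "nat \<Rightarrow> 'a::second_countable_topology \<Rightarrow> bool"
  assumes "\<And>i. Sigma1_pred n (P i)"
  shows "Sigma1_pred (n + 2) (\<lambda>x. \<forall>i. P i x)"
  using Sigma1_pred_not[OF Sigma1_pred_not_all[OF assms]] by simp

lemma Sigma1_pred_conj:
  fixes P Q :: "'a::second_countable_topology \<Rightarrow> bool"
  assumes "Sigma1_pred n P" "Sigma1_pred n Q"
  shows "Sigma1_pred (n + 2) (\<lambda>x. P x \<and> Q x)"
proof -
  have "Sigma1_pred (n + 2) (\<lambda>x. \<forall>i::nat. (if i = 0 then P else Q) x)"
    using assms by (intro Sigma1_pred_all) auto
  moreover have "(\<lambda>x. \<forall>i::nat. (if i = 0 then P else Q) x) = (\<lambda>x. P x \<and> Q x)"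
    by (auto simp: fun_eq_iff)
  ultimately show ?thesis by simp
qed

lemma Sigma1_pred_imp:
  fixes P Q :: "'a::second_countable_topology \<Rightarrow> bool"
  assumes "Sigma1_pred n P" "Sigma1_pred n Q"
  shows "Sigma1_pred (n + 4) (\<lambda>x. P x \<longrightarrow> Q x)"
proof -
  have "Sigma1_pred (Suc (n + 1 + 2)) (\<lambda>x. \<not> (P x \<and> \<not> Q x))"
    using Sigma1_pred_not[OF assms(2)] Sigma1_pred_Suc[OF assms(1)]
    by (intro Sigma1_pred_not Sigma1_pred_conj) auto
  then show ?thesis by (simp add: eval_nat_numeral)
qed

text \<open>The characteristic function of \<open>F x\<close> is a Borel map into the Cantor space,
  so the predicate is a preimage of the projective set that codes \<open>H\<close>. One
  \<open>n\<close> serves all \<open>F\<close>, which bounds the rules of the game uniformly in the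
  round.\<close>

lemma Sigma1_pred_mem_family:
  assumes "projective_family H"
  obtains n where
    "\<And>F :: 'a::second_countable_topology \<Rightarrow> nat set. (\<And>m. Measurable.pred borel (\<lambda>x. m \<in> F x)) \<Longrightarrow> Sigma1_pred n (\<lambda>x. F x \<in> H)"
proof -
  let ?chi = "\<lambda>A. (\<lambda>n. n \<in> A) :: nat \<Rightarrow> bool"
  obtain n where n: "Sigma1_pred n (\<lambda>u. u \<in> ?chi ` H)"
    using assms unfolding projective_family_def projective_def Sigma1_pred_def by auto
  have "Sigma1_pred n (\<lambda>x. F x \<in> H)"
    if F: "\<And>m. Measurable.pred borel (\<lambda>x. m \<in> F x)" for F :: "'a \<Rightarrow> nat set"
  proof -
    have "(\<lambda>x. ?chi (F x)) \<in> borel_measurable borel"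
      using F by (intro measurable_coordinatewise_then_product)
        (simp add: measurable_def sets_borel_eq_count_space pred_def)
    from Sigma1_pred_compose[OF this n] 
    have "Sigma1_pred n (\<lambda>x. ?chi (F x) \<in> ?chi ` H)" .
    moreover have "?chi B \<in> ?chi ` H \<longleftrightarrow> B \<in> H" for B
      by (auto simp: fun_eq_iff set_eq_iff[symmetric])
    ultimately show ?thesis by simp
  qed
  then show thesis by (rule that)
qed

subsection \<open>Coding sets by reals\<close>

text \<open>Reading ternary digits makes \<open>decode\<close> surjective: sums of distinct powers of \<open>1/3\<close> have no ambiguous expansions.\<close>

definition decode :: "real \<Rightarrow> nat set" where
  "decode r = {n. \<lfloor>3 ^ n * r\<rfloor> mod 3 = 1}"

lemma surj_decode: "surj decode"
proof (rule surjI)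
  fix A :: "nat set"
  define a :: "nat \<Rightarrow> real" where "a n = of_bool (n \<in> A)" for n
  have a: "0 \<le> a n" "a n \<le> 1" for n by (auto simp: a_def)
  have summ: "summable (\<lambda>n. a (n + k) / 3 ^ n)" for k
    by (rule summable_comparison_test[OF _ summable_geometric[of "1 / 3 :: real"]])
      (use a in \<open>auto simp: power_divide divide_right_mono\<close>)
  \<comment> \<open>\<open>s 0\<close> is the real that codes \<open>A\<close>; \<open>s k\<close>
    is the tail of its ternary expansion from digit \<open>k\<close> on, rescaled so that this digit
    becomes the integer place.\<close>
  define s where "s k = (\<Sum>n. a (n + k) / 3 ^ n)" for k
  have s_Suc: "3 * s k = 3 * a k + s (Suc k)" for k
  proof -
    have "s k = (\<Sum>n. a (Suc n + k) / 3 ^ Suc n) + a k"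
      unfolding s_def using suminf_split_head[OF summ[of k]] by simp
    also have "(\<Sum>n. a (Suc n + k) / 3 ^ Suc n) = (\<Sum>n. (1/3) * (a (n + Suc k) / 3 ^ n))"
      by (simp add: field_simps)
    also have "\<dots> = (1/3) * s (Suc k)"
      unfolding s_def by (rule suminf_mult[OF summ])
    finally show ?thesis by simp
  qed
  \<comment> \<open>As only the digits 0 and 1 occur, the remainder \<open>s (Suc n) / 3\<close>
    after digit \<open>n\<close> stays at most 1/2, so taking the floor reads off that digit
    exactly.\<close>
  have s_le: "s k \<le> 3 / 2" for k
  proof -
    have "s k \<le> (\<Sum>n. (1 / 3 :: real) ^ n)"
      unfolding s_def using a summ
      by (intro suminf_le summable_geometric) (auto simp: power_divide divide_right_mono)
    also have "\<dots> = 3 / 2" by (subst suminf_geometric) auto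
    finally show ?thesis .
  qed
  have s_ge: "0 \<le> s k" for k
    unfolding s_def using a summ by (intro suminf_nonneg) auto
  have "\<exists>z::int. 3 ^ n * s 0 = 3 * z + s n" for n
  proof (induction n)
    case (Suc n)
    then obtain z :: int where z: "3 ^ n * s 0 = 3 * z + s n" by auto
    have "3 ^ Suc n * s 0 = 3 * (3 ^ n * s 0)" by simp
    also have "\<dots> = 3 * of_int (3 * z + of_bool (n \<in> A)) + s (Suc n)"
      using s_Suc[of n] z by (simp add: a_def del: of_bool_eq_0_iff)
    finally show ?case by blast
  qed (auto intro: exI[of _ 0])
  have "\<lfloor>3 ^ n * s 0\<rfloor> mod 3 = of_bool (n \<in> A)" for n
  proof -
    obtain z :: int where z: "3 ^ n * s 0 = 3 * z + s n"
      using \<open>\<exists>z::int. 3 ^ n * s 0 = 3 * z + s n\<close> by auto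
    have "\<lfloor>3 ^ n * s 0\<rfloor> = 3 * z + of_bool (n \<in> A)"
      using s_Suc[of n] s_le[of "Suc n"] s_ge[of "Suc n"] unfolding z
      by (intro floor_unique) (auto simp: a_def)
    then show ?thesis by simp
  qed
  then show "decode (s 0) = A"
    by (auto simp: decode_def)
qed

lemma pred_mem_decode: "Measurable.pred borel (\<lambda>x :: nat \<Rightarrow> real. m \<in> decode (x i))"
proof -
  have "(\<lambda>x :: nat \<Rightarrow> real. x i) \<in> borel_measurable borel"
    by (intro borel_measurable_continuous_onI)
      (rule continuous_on_product_then_coordinatewise[OF continuous_on_id])
  then have [measurable]: "(\<lambda>x :: nat \<Rightarrow> real. \<lfloor>3 ^ m * x i\<rfloor>) \<in> measurable borel (count_space UNIV)"
    by (intro measurable_compose[OF _ measurable_real_floor]) simp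
  have "Measurable.pred borel (\<lambda>x :: nat \<Rightarrow> real. (\<lambda>z. z mod 3 = 1) \<lfloor>3 ^ m * x i\<rfloor>)"
    by (rule measurable_compose[where N = "count_space UNIV"]) (measurable)
  then show ?thesis by (simp add: decode_def)
qed

subsection \<open>Semiselective coideals\<close>

lemma coideal_mono: "coideal H \<Longrightarrow> A \<in> H \<Longrightarrow> A \<subseteq> B \<Longrightarrow> B \<in> H"
  unfolding coideal_def by blast

lemma coideal_empty: "coideal H \<Longrightarrow> {} \<notin> H"
  unfolding coideal_def by blast

lemma coideal_Un: "coideal H \<Longrightarrow> A \<union> B \<in> H \<Longrightarrow> A \<in> H \<or> B \<in> H"
  unfolding coideal_def by blast

lemma coideal_Diff:
  assumes "coideal H" "A \<in> H" "B \<notin> H"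
  shows "A - B \<in> H"
proof -
  have "(A - B) \<union> B \<in> H"
    using assms(2) by (rule coideal_mono[OF assms(1)]) blast
  then show ?thesis using coideal_Un[OF assms(1)] assms(3) by blast
qed

lemma coideal_UN:
  assumes "coideal H" "finite I" "\<And>i. i \<in> I \<Longrightarrow> F i \<notin> H"
  shows "(\<Union>i\<in>I. F i) \<notin> H"
  using assms(2,3)
  by (induction I) (use coideal_empty[OF assms(1)] coideal_Un[OF assms(1)] in auto)

text \<open>A minimal singleton would be its own diagonalization, and its tail is empty.\<close>

lemma semiselective_infinite:
  assumes H: "coideal H" and ss: "semiselective H" and A: "A \<in> H"
  shows "infinite A"
proof
  assume "finite A"
  then obtain k where k: "{k} \<in> H"
    using coideal_UN[OF H \<open>finite A\<close>, of "\<lambda>k. {k}"] A by auto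
  have "dense_open H H" by (auto simp: dense_open_def)
  then obtain B where "B \<in> H" "B \<subseteq> {k}" "\<forall>n\<in>B. {m\<in>B. m > n} \<in> H"
    using ss[unfolded semiselective_def, rule_format, of "\<lambda>_. H"] k by blast
  moreover from this have "B = {k}" using coideal_empty[OF H] by (metis subset_singletonD)
  ultimately have "{m\<in>{k}. m > k} \<in> H" by blast
  moreover have "{m\<in>{k}. m > k} = {}" by auto
  ultimately show False using coideal_empty[OF H] by metis
qed

section \<open>Diagonalization and antichains in a semiselective coideal\<close>

locale semiselective_coideal =
  fixes H :: "nat set set"
  assumes coideal: "coideal H" and semiselective: "semiselective H"
begin

lemmas mono = coideal_mono[OF coideal]
lemmas infinite_mem = semiselective_infinite[OF coideal semiselective]

lemma Diff_finite: "A \<in> H \<Longrightarrow> finite B \<Longrightarrow> A - B \<in> H"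
  using coideal_Diff[OF coideal] infinite_mem by blast

lemma above_mem: "A \<in> H \<Longrightarrow> {m\<in>A. m > n} \<in> H"
  by (rule mono[OF Diff_finite[of A "{..n}"]]) auto

text \<open>Semiselectivity speaks of density in all of \<open>H\<close>, while here it is given
  below \<open>A\<close> only. Adding to \<open>D n\<close> every element of \<open>H\<close> whose
  trace on \<open>A\<close> is outside \<open>H\<close> makes it dense everywhere, and no tail of a
  \<open>B \<subseteq> A\<close> in \<open>H\<close> is of the added kind.\<close>

lemma diagonalize_below:
  assumes A: "A \<in> H"
    and D: "\<And>n. D n \<subseteq> H"
    and dense: "\<And>n E. E \<in> H \<Longrightarrow> E \<subseteq> A \<Longrightarrow> \<exists>F\<in>D n. F \<subseteq> E"
    and down: "\<And>n E F. E \<in> D n \<Longrightarrow> F \<in> H \<Longrightarrow> F \<subseteq> E \<Longrightarrow> F \<in> D n"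
  shows "\<exists>B\<in>H. B \<subseteq> A \<and> (\<forall>n\<in>B. {m\<in>B. m > n} \<in> D n)"
proof -
  define D' where "D' n = D n \<union> {E \<in> H. E \<inter> A \<notin> H}" for n
  have "dense_open H (D' n)" for n
    unfolding dense_open_def
  proof (intro conjI ballI impI)
    show "D' n \<subseteq> H" using D by (auto simp: D'_def)
    show "\<exists>F\<in>D' n. F \<subseteq> E" if "E \<in> H" for E
    proof (cases "E \<inter> A \<in> H")
      case True
      then show ?thesis using dense[of "E \<inter> A" n] by (auto simp: D'_def)
    qed (use that in \<open>auto simp: D'_def\<close>)
    show "F \<in> D' n" if "E \<in> D' n" "F \<in> H" "F \<subseteq> E" for E F
    proof (cases "E \<in> D n")
      case False
      then have "E \<inter> A \<notin> H" using that by (auto simp: D'_def)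
      then have "F \<inter> A \<notin> H" using mono[of "F \<inter> A" "E \<inter> A"] that by blast
      then show ?thesis using that by (auto simp: D'_def)
    qed (use that down in \<open>auto simp: D'_def\<close>)
  qed
  then obtain B where B: "B \<in> H" "B \<subseteq> A" "\<forall>n\<in>B. {m\<in>B. m > n} \<in> D' n"
    using semiselective A unfolding semiselective_def by blast
  have "{m\<in>B. m > n} \<in> D n" if "n \<in> B" for n
  proof -
    have "{m\<in>B. m > n} \<inter> A = {m\<in>B. m > n}" using B by auto
    then show ?thesis using B(3) that above_mem[OF B(1)] by (auto simp: D'_def)
  qed
  with B show ?thesis by blast
qed

text \<open>The tasks are met one after another by shrinking the set; since \<open>T\<close> is
  inherited by subsets, those already met stay met.\<close>

lemma finite_tasks:
  assumes "finite Q" "E \<in> H"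
    and down: "\<And>L F G. L \<in> Q \<Longrightarrow> T L F \<Longrightarrow> G \<subseteq> F \<Longrightarrow> T L G"
    and ex: "\<And>L F. L \<in> Q \<Longrightarrow> F \<in> H \<Longrightarrow> F \<subseteq> E \<Longrightarrow> \<exists>G\<in>H. G \<subseteq> F \<and> T L G"
  shows "\<exists>F\<in>H. F \<subseteq> E \<and> (\<forall>L\<in>Q. T L F)"
  using assms
proof (induction Q)
  case (insert L Q)
  have "\<exists>F\<in>H. F \<subseteq> E \<and> (\<forall>L\<in>Q. T L F)"
    by (rule insert.IH) (use insert.prems in \<open>blast+\<close>)
  then obtain F where F: "F \<in> H" "F \<subseteq> E" "\<forall>L\<in>Q. T L F" by blast
  then obtain G where G: "G \<in> H" "G \<subseteq> F" "T L G"
    using insert.prems(3)[of L F] by blast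
  have "T K G" if "K \<in> insert L Q" for K
    using that F(3) G insert.prems(2)[of K F G] by blast
  with F(2) G show ?case by blast
qed auto

text \<open>Two elements of \<open>H\<close> have a common lower bound in \<open>H\<close> iff their
  intersection is in \<open>H\<close>, so \<open>M\<close> is an antichain that is predense below
  \<open>A\<close>. Zorn's lemma gives a maximal one; a set below \<open>A\<close> incompatible with
  all its members would contain an element of \<open>D\<close> that could be added.\<close>

lemma maximal_antichain:
  assumes D: "D \<subseteq> H" and dense: "\<And>E. E \<in> H \<Longrightarrow> E \<subseteq> A \<Longrightarrow> \<exists>F\<in>D. F \<subseteq> E"
  shows "\<exists>M. M \<subseteq> D \<and> (\<forall>E\<in>M. \<forall>F\<in>M. E \<inter> F \<in> H \<longrightarrow> E = F) \<and>
    (\<forall>E\<in>H. E \<subseteq> A \<longrightarrow> (\<exists>F\<in>M. E \<inter> F \<in> H))"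
proof -
  define anti where "anti M \<longleftrightarrow> M \<subseteq> D \<and> (\<forall>E\<in>M. \<forall>F\<in>M. E \<inter> F \<in> H \<longrightarrow> E = F)" for M
  have "\<exists>M\<in>Collect anti. \<forall>X\<in>Collect anti. M \<subseteq> X \<longrightarrow> X = M"
  proof (rule subset_Zorn')
    fix C assume C: "subset.chain (Collect anti) C"
    then have sub: "\<And>X. X \<in> C \<Longrightarrow> anti X"
      by (auto simp: subset_chain_def)
    have tot: "X \<subseteq> Y \<or> Y \<subseteq> X" if "X \<in> C" "Y \<in> C" for X Y
      using C that by (auto simp: subset_chain_def)
    have "E = F" if "E \<in> X" "X \<in> C" "F \<in> Y" "Y \<in> C" "E \<inter> F \<in> H" for E F X Y
      using tot[OF that(2,4)] sub that unfolding anti_def by (meson subsetD)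
    moreover have "\<Union>C \<subseteq> D" using sub by (auto simp: anti_def)
    ultimately show "\<Union>C \<in> Collect anti" unfolding anti_def by blast
  qed
  then obtain M where M: "anti M" and max: "\<And>X. anti X \<Longrightarrow> M \<subseteq> X \<Longrightarrow> X = M"
    by blast
  have "\<exists>F\<in>M. E \<inter> F \<in> H" if E: "E \<in> H" "E \<subseteq> A" for E
  proof -
    obtain G where G: "G \<in> D" "G \<subseteq> E" using dense[OF E] by blast
    have "\<exists>F\<in>M. G \<inter> F \<in> H"
    proof (rule ccontr)
      assume none: "\<not> ?thesis"
      have "anti (insert G M)"
        using M G none unfolding anti_def by (auto simp: Int_commute)
      then have "G \<in> M" using max[of "insert G M"] by blast
      moreover have "G \<inter> G \<in> H" using G D by auto
      ultimately show False using none by blast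
    qed
    then obtain F where "F \<in> M" "G \<inter> F \<in> H" by blast
    then show ?thesis using mono[of "G \<inter> F" "E \<inter> F"] G by blast
  qed
  with M show ?thesis
    unfolding anti_def by (intro exI[of _ M] conjI ballI impI) auto
qed

text \<open>
  Forcing with \<open>(H, \<subseteq>)\<close> adds no new \<open>\<omega>\<close>-sequences: the \<open>n\<close>-th state is decided by a maximal antichain,
  each refining the previous one, so the choices made below the tails \<open>B/n\<close> cohere.
\<close>

lemma dependent_diagonalization:
  fixes inv :: "'s \<Rightarrow> nat set \<Rightarrow> bool" and trans :: "nat \<Rightarrow> 's \<Rightarrow> 's \<Rightarrow> nat set \<Rightarrow> bool"
  assumes A: "A \<in> H" and init: "inv s0 A"
    and down: "\<And>s E F. inv s E \<Longrightarrow> F \<subseteq> E \<Longrightarrow> inv s F"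
    and step: "\<And>n s E. E \<in> H \<Longrightarrow> inv s E \<Longrightarrow>
      \<exists>F\<in>H. F \<subseteq> E \<and> (\<exists>t. trans n s t F \<and> inv t F)"
    and down_trans: "\<And>n s t E F. trans n s t E \<Longrightarrow> F \<subseteq> E \<Longrightarrow> trans n s t F"
  shows "\<exists>B s. B \<in> H \<and> B \<subseteq> A \<and> s 0 = s0 \<and>
    (\<forall>n. \<exists>E\<in>H. trans n (s n) (s (Suc n)) E \<and> inv (s (Suc n)) E \<and>
      (n \<in> B \<longrightarrow> {m\<in>B. m > n} \<subseteq> E))"
proof -
  \<comment> \<open>A pair consists of an antichain, predense below \<open>A\<close>, and a
    labelling of its members by states that satisfy the invariant. \<open>R\<close> makes the next
    antichain refine the present one, with labels evolving by \<open>trans\<close> along the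
    refinement.\<close>
  define P where "P p \<longleftrightarrow> fst p \<subseteq> H \<and> (\<forall>E\<in>fst p. \<forall>F\<in>fst p. E \<inter> F \<in> H \<longrightarrow> E = F) \<and>
    (\<forall>E\<in>H. E \<subseteq> A \<longrightarrow> (\<exists>F\<in>fst p. E \<inter> F \<in> H)) \<and> (\<forall>E\<in>fst p. inv (snd p E) E)"
    for p :: "nat set set \<times> (nat set \<Rightarrow> 's)"
  define R where "R n p q \<longleftrightarrow>
    (\<forall>F\<in>fst q. \<exists>E\<in>fst p. F \<subseteq> E \<and> trans n (snd p E) (snd q F) F)"
    for n and p q :: "nat set set \<times> (nat set \<Rightarrow> 's)"
  have init_P: "P ({A}, \<lambda>_. s0)"
    using A init by (auto simp: P_def Int_absorb2)
  have step_P: "\<exists>q. P q \<and> R n p q" if p: "P p" for p n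
  proof -
    obtain M f where Mf: "p = (M, f)" by fastforce
    define good where "good E s \<longleftrightarrow> (\<exists>F\<in>M. E \<subseteq> F \<and> trans n (f F) s E \<and> inv s E)" for E s
    have dense: "\<exists>F\<in>{E\<in>H. \<exists>s. good E s}. F \<subseteq> E" if E: "E \<in> H" "E \<subseteq> A" for E
    proof -
      obtain F where F: "F \<in> M" "E \<inter> F \<in> H" "inv (f F) F"
        using p E by (auto simp: P_def Mf)
      from F(3) have "inv (f F) (E \<inter> F)" by (rule down) simp
      from step[OF F(2) this, of n] obtain G t where
        "G \<in> H" "G \<subseteq> E \<inter> F" "trans n (f F) t G" "inv t G" by blast
      then show ?thesis using F(1) unfolding good_def by blast
    qed
    have sub: "{E\<in>H. \<exists>s. good E s} \<subseteq> H" by blast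
    have "\<exists>M'. M' \<subseteq> {E\<in>H. \<exists>s. good E s} \<and>
        (\<forall>E\<in>M'. \<forall>F\<in>M'. E \<inter> F \<in> H \<longrightarrow> E = F) \<and>
        (\<forall>E\<in>H. E \<subseteq> A \<longrightarrow> (\<exists>F\<in>M'. E \<inter> F \<in> H))"
      by (rule maximal_antichain[OF sub dense])
    then obtain M' where M': "M' \<subseteq> {E\<in>H. \<exists>s. good E s}"
      "\<forall>E\<in>M'. \<forall>F\<in>M'. E \<inter> F \<in> H \<longrightarrow> E = F"
      "\<forall>E\<in>H. E \<subseteq> A \<longrightarrow> (\<exists>F\<in>M'. E \<inter> F \<in> H)"
      by (elim exE conjE) (rule that)
    define f' where "f' E = (SOME s. good E s)" for E
    have f': "good E (f' E)" if "E \<in> M'" for E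
    proof -
      have "\<exists>s. good E s" using M'(1) that by blast
      then show ?thesis unfolding f'_def by (rule someI_ex)
    qed
    have "P (M', f')"
    proof -
      have "inv (f' E) E" if "E \<in> M'" for E
        using f'[OF that] unfolding good_def by blast
      with M' show ?thesis unfolding P_def by auto
    qed
    moreover have "R n p (M', f')"
      unfolding R_def Mf fst_conv snd_conv
    proof
      fix F assume "F \<in> M'"
      from f'[OF this] show "\<exists>E\<in>M. F \<subseteq> E \<and> trans n (f E) (f' F) F"
        unfolding good_def by blast
    qed
    ultimately show ?thesis by blast
  qed
  have "\<exists>p. \<forall>n. (P (p n) \<and> (n = 0 \<longrightarrow> p n = ({A}, \<lambda>_. s0))) \<and> R n (p n) (p (Suc n))"
    by (rule dependent_nat_choice) (use init_P step_P in auto)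
  then obtain p where p: "\<And>n. P (p n)" "p 0 = ({A}, \<lambda>_. s0)" "\<And>n. R n (p n) (p (Suc n))"
    by blast
  define M where "M n = fst (p n)" for n
  define f where "f n = snd (p n)" for n
  have M_H: "\<And>n. M n \<subseteq> H"
    and uniq: "\<And>n E F. E \<in> M n \<Longrightarrow> F \<in> M n \<Longrightarrow> E \<inter> F \<in> H \<Longrightarrow> E = F"
    and pre: "\<And>n E. E \<in> H \<Longrightarrow> E \<subseteq> A \<Longrightarrow> \<exists>F\<in>M n. E \<inter> F \<in> H"
    and inv: "\<And>n E. E \<in> M n \<Longrightarrow> inv (f n E) E"
    using p(1) unfolding P_def M_def f_def by blast+
  have refine: "\<exists>E\<in>M n. F \<subseteq> E \<and> trans n (f n E) (f (Suc n) F) F" if "F \<in> M (Suc n)" for n F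
    using p(3)[of n] that unfolding R_def M_def f_def by blast
  \<comment> \<open>Level \<open>Suc n\<close> is used, so that the tail of \<open>B\<close> above
    \<open>n\<close> already decides the state reached after step \<open>n\<close>.\<close>
  define D where "D n = {E\<in>H. \<exists>F\<in>M (Suc n). E \<subseteq> F}" for n
  have "\<exists>B\<in>H. B \<subseteq> A \<and> (\<forall>n\<in>B. {m\<in>B. m > n} \<in> D n)"
  proof (rule diagonalize_below[OF A])
    show "\<exists>F\<in>D n. F \<subseteq> E" if E: "E \<in> H" "E \<subseteq> A" for n E
    proof -
      obtain F where "F \<in> M (Suc n)" "E \<inter> F \<in> H" using pre[OF E] by blast
      then show ?thesis unfolding D_def by (intro bexI[of _ "E \<inter> F"]) auto
    qed
    show "D n \<subseteq> H" for n
      by (auto simp: D_def)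
    show "F \<in> D n" if "E \<in> D n" "F \<in> H" "F \<subseteq> E" for n E F
      using that by (auto simp: D_def)
  qed
  then obtain B where B: "B \<in> H" "B \<subseteq> A" and BD: "\<forall>n\<in>B. {m\<in>B. m > n} \<in> D n"
    by (elim bexE conjE) (rule that)
  have descend: "\<exists>F\<in>M n. E \<subseteq> F" if "n \<le> k" "E \<in> M k" for n k E
    using that
  proof (induction arbitrary: E rule: dec_induct)
    case (step k)
    obtain F where "F \<in> M k" "E \<subseteq> F" using refine[OF step.prems] by (elim bexE conjE) (rule that)
    then show ?case using step.IH[of F] by (meson subset_trans)
  qed auto
  \<comment> \<open>The diagonalization controls only indices in \<open>B\<close>. For any other
    \<open>n\<close>, pass to a larger \<open>k\<close> in \<open>B\<close> and descend through the
    refinements.\<close>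
  have "\<exists>F\<in>M n. \<exists>k. {m\<in>B. m > k} \<subseteq> F" for n
  proof -
    obtain k where k: "k \<in> B" "k \<ge> n"
      using infinite_mem[OF B(1)] by (metis infinite_nat_iff_unbounded_le)
    then obtain E where E: "E \<in> M (Suc k)" "{m\<in>B. m > k} \<subseteq> E"
      using bspec[OF BD k(1)] unfolding D_def by blast
    then show ?thesis using descend[OF le_SucI[OF k(2)] E(1)] by blast
  qed
  then obtain u where u: "\<And>n. u n \<in> M n" "\<And>n. \<exists>k. {m\<in>B. m > k} \<subseteq> u n" by metis
  \<comment> \<open>Any two tails of \<open>B\<close> share a tail, which is in \<open>H\<close>, so
    the antichain property leaves one member per level that contains a tail. This uniqueness makes
    the chosen states cohere.\<close>
  have u_eq: "F = u n" if F: "F \<in> M n" "{m\<in>B. m > k} \<subseteq> F" for F n k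
  proof -
    obtain l where "{m\<in>B. m > l} \<subseteq> u n" using u by blast
    with F have "{m\<in>B. m > max k l} \<subseteq> F \<inter> u n" by auto
    then show ?thesis using uniq F(1) u(1) mono above_mem[OF B(1)] by blast
  qed
  show ?thesis
  proof (intro exI[of _ B] exI[of _ "\<lambda>n. f n (u n)"] conjI allI B)
    show "f 0 (u 0) = s0" using p(2) by (simp add: f_def)
    fix n
    obtain E where E: "E \<in> M n" "u (Suc n) \<subseteq> E" "trans n (f n E) (f (Suc n) (u (Suc n))) (u (Suc n))"
      using refine[OF u(1)] by blast
    have "E = u n" using u_eq[OF E(1)] u(2)[of "Suc n"] E(2) by blast
    moreover have "{m\<in>B. m > n} \<subseteq> u (Suc n)" if "n \<in> B"
      using bspec[OF BD that] u_eq unfolding D_def by blast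
    ultimately show "\<exists>E\<in>H. trans n (f n (u n)) (f (Suc n) (u (Suc n))) E \<and> inv (f (Suc n) (u (Suc n))) E \<and> (n \<in> B \<longrightarrow> {m\<in>B. m > n} \<subseteq> E)"
      using E(3) inv[OF u(1)] u(1) M_H by blast
  qed
qed

end

subsection \<open>Strategies\<close>

text \<open>This removes the minimum of a nonempty set. The quantifier over natural numbers makes it
  evident that membership is Borel when \<open>C\<close> depends measurably on a run.\<close>

definition rest :: "nat set \<Rightarrow> nat set" where
  "rest C = {m\<in>C. \<exists>j\<in>C. j < m}"

lemma rest_eq: "rest C = C - {Inf C}"
proof (cases "C = {}")
  case False
  then have "Inf C \<in> C" by (rule Inf_nat_def1)
  moreover have "Inf C \<le> m" if "m \<in> C" for m
    using that by (rule wellorder_Inf_le1)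
  ultimately show ?thesis
    unfolding rest_def by (auto simp: le_less) (metis less_irrefl le_less_trans order.strict_iff_order)
qed (simp add: rest_def)

lemma Inf_less_rest: "m \<in> rest C \<Longrightarrow> Inf C < m"
  unfolding rest_def by (auto dest: wellorder_Inf_le1)

lemma Diff_rest: "C \<noteq> {} \<Longrightarrow> C - rest C = {Inf C}"
  using Inf_nat_def1[of C] by (auto simp: rest_eq)

context semiselective_coideal
begin

text \<open>Only one player's moves are listed, and \<open>g\<close> computes from them the set
  bounding the next move: the strategy of I if the list holds moves of II, and what is left of II's
  last answer if it holds moves of I.\<close>

definition legal :: "(nat set list \<Rightarrow> nat set) \<Rightarrow> nat set list \<Rightarrow> bool" where
  "legal g L \<longleftrightarrow> (\<forall>j<length L. L ! j \<in> H \<and> L ! j \<subseteq> g (take j L))"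

lemma legal_Nil [simp]: "legal g []"
  by (simp add: legal_def)

lemma legal_snoc [simp]: "legal g (L @ [D]) \<longleftrightarrow> legal g L \<and> D \<in> H \<and> D \<subseteq> g L"
  unfolding legal_def by (auto simp: nth_append less_Suc_eq)

lemma rest_mem: "C \<in> H \<Longrightarrow> rest C \<in> H"
  unfolding rest_eq by (rule Diff_finite) auto

lemma nonempty_mem: "C \<in> H \<Longrightarrow> C \<noteq> {}"
  using coideal_empty[OF coideal] by auto

lemma legal_branch:
  assumes "L 0 = []" "\<And>j. \<exists>D. L (Suc j) = L j @ [D] \<and> Q j (L j) D"
  obtains X where "\<And>j. L j = map X [0..<j]" "\<And>j. Q j (map X [0..<j]) (X j)"
proof -
  obtain X where X: "\<And>j. L (Suc j) = L j @ [X j]" "\<And>j. Q j (L j) (X j)"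
    using assms(2) by metis
  have L: "L j = map X [0..<j]" for j
    by (induction j) (use assms(1) X(1) in auto)
  have "Q j (map X [0..<j]) (X j)" for j using X(2)[of j] L by simp
  with L show thesis by (rule that)
qed

text \<open>
  Only the tree of positions needs to survive here, so the infinite set is built by plain fusion and
  is not required to lie in \<open>H\<close>; in particular this direction uses no diagonalization.
\<close>

lemma winning_I_imp:
  assumes legal_I: "\<And>L. legal \<sigma> L \<Longrightarrow> \<sigma> L \<in> H \<and> \<sigma> L \<subseteq> (if L = [] then A else rest (last L))"
    and wins: "\<And>X. (\<And>k. legal \<sigma> (map X [0..<k])) \<Longrightarrow> (\<Union>k. X k - rest (X k)) \<in> H"
  shows "\<exists>B. B \<subseteq> A \<and> infinite B \<and> (\<forall>C. C \<subseteq> B \<and> infinite C \<longrightarrow> C \<in> H)"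
proof -
  \<comment> \<open>The stages of the fusion: a reservoir in \<open>H\<close> and a finite set of
    positions, each of whose answers by I contains the reservoir.\<close>
  define P where "P p \<longleftrightarrow> fst p \<in> H \<and> finite (snd p) \<and> (\<forall>L\<in>snd p. legal \<sigma> L \<and> fst p \<subseteq> \<sigma> L)"
    for p :: "nat set \<times> nat set list set"
  define R where "R p q \<longleftrightarrow> fst q \<subseteq> rest (fst p) \<and> snd p \<subseteq> snd q \<and>
      (\<forall>L\<in>snd p. \<exists>D. L @ [D] \<in> snd q \<and> Inf D = Inf (fst p))"
    for p q :: "nat set \<times> nat set list set"
  have init: "P (\<sigma> [], {[]})"
    using legal_I[of "[]"] by (simp add: P_def)
  have step: "\<exists>q. P q \<and> R p q" if p: "P p" for p
  proof -
    obtain C Q where CQ: "p = (C, Q)" by fastforce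
    have C: "C \<in> H" "finite Q" "\<And>L. L \<in> Q \<Longrightarrow> legal \<sigma> L \<and> C \<subseteq> \<sigma> L"
      using p by (auto simp: P_def CQ)
    define T where "T L F \<longleftrightarrow> (\<exists>D. D \<in> H \<and> D \<subseteq> \<sigma> L \<and> Inf D = Inf C \<and> F \<subseteq> \<sigma> (L @ [D]))" for L F
    have ex: "\<exists>G\<in>H. G \<subseteq> F \<and> T L G" if L: "L \<in> Q" and F: "F \<in> H" "F \<subseteq> rest C" for L F
    proof -
      \<comment> \<open>II's move contributes exactly \<open>Inf C\<close> to the outcome, and I
        must answer it inside \<open>F\<close>.\<close>
      define D where "D = insert (Inf C) F"
      have D: "D \<in> H" "D \<subseteq> C"
        using mono[OF F(1), of D] F(2) Inf_nat_def1[OF nonempty_mem[OF C(1)]] by (auto simp: D_def rest_eq)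
      have "Inf D = Inf C"
      proof (rule antisym)
        show "Inf D \<le> Inf C" by (rule wellorder_Inf_le1) (simp add: D_def)
        show "Inf C \<le> Inf D"
          using Inf_nat_def1[OF nonempty_mem[OF D(1)]] D(2) by (intro wellorder_Inf_le1) auto
      qed
      moreover have "legal \<sigma> (L @ [D])" using C(3)[OF L] D by auto
      from legal_I[OF this] have "\<sigma> (L @ [D]) \<in> H" "\<sigma> (L @ [D]) \<subseteq> rest D" by auto
      moreover have "rest D \<subseteq> F" unfolding rest_eq[of D] \<open>Inf D = Inf C\<close> by (auto simp: D_def)
      ultimately show ?thesis
        unfolding T_def using D C(3)[OF L] by (intro bexI[of _ "\<sigma> (L @ [D])"] conjI exI[of _ D]) auto
    qed
    have "\<exists>F\<in>H. F \<subseteq> rest C \<and> (\<forall>L\<in>Q. T L F)"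
      by (rule finite_tasks[OF C(2) rest_mem[OF C(1)] _ ex]) (unfold T_def, blast)
    then obtain F where F: "F \<in> H" "F \<subseteq> rest C" "\<forall>L\<in>Q. T L F" by (elim bexE conjE) (rule that)
    obtain d where d: "\<And>L. L \<in> Q \<Longrightarrow> d L \<in> H \<and> d L \<subseteq> \<sigma> L \<and> Inf (d L) = Inf C \<and> F \<subseteq> \<sigma> (L @ [d L])"
      using bchoice[OF F(3)[unfolded T_def]] by auto
    \<comment> \<open>Keeping the old positions allows a number to be skipped; the new ones use it.
      Thus every finite set of chosen numbers is played in some position.\<close>
    define Q' where "Q' = Q \<union> (\<lambda>L. L @ [d L]) ` Q"
    have "F \<subseteq> \<sigma> L" if "L \<in> Q" for L
      using F(2) C(3)[OF that] by (auto simp: rest_def)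
    then have "legal \<sigma> M \<and> F \<subseteq> \<sigma> M" if "M \<in> Q'" for M
      using that C(3) d unfolding Q'_def by (elim UnE imageE) simp_all
    then have "P (F, Q')"
      using C(2) F(1) unfolding P_def by (auto simp: Q'_def)
    moreover have "R p (F, Q')"
      using d F(2) unfolding R_def Q'_def CQ by auto
    ultimately show ?thesis by blast
  qed
  have "\<exists>p. \<forall>n. (P (p n) \<and> (n = 0 \<longrightarrow> p n = (\<sigma> [], {[]}))) \<and> R (p n) (p (Suc n))"
    by (rule dependent_nat_choice) (use init step in auto)
  then obtain p where p: "\<And>n. P (p n)" "p 0 = (\<sigma> [], {[]})" "\<And>n. R (p n) (p (Suc n))" by blast
  define C where "C n = fst (p n)" for n
  define Q where "Q n = snd (p n)" for n
  define e where "e n = Inf (C n)" for n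
  have C: "\<And>n. C n \<in> H" "\<And>n. C (Suc n) \<subseteq> rest (C n)" "C 0 \<subseteq> A"
    and Q: "\<And>n L. L \<in> Q n \<Longrightarrow> legal \<sigma> L" "\<And>n. Q n \<subseteq> Q (Suc n)" "Q 0 = {[]}"
    and ext: "\<And>n L. L \<in> Q n \<Longrightarrow> \<exists>D. L @ [D] \<in> Q (Suc n) \<and> Inf D = e n"
    using p legal_I[of "[]"] unfolding P_def R_def C_def Q_def e_def by auto
  have Q_mono: "Q m \<subseteq> Q n" if "m \<le> n" for m n
    using Q(2) that by (rule lift_Suc_mono_le)
  have e_in: "e n \<in> C n" for n
    unfolding e_def using nonempty_mem[OF C(1)] by (rule Inf_nat_def1)
  have C_anti: "C n \<subseteq> C 0" for n
    by (rule lift_Suc_antimono_le[of C]) (use C(2) in \<open>auto simp: rest_def\<close>)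
  have e_mono: "strict_mono e"
    unfolding strict_mono_Suc_iff using e_in C(2) Inf_less_rest unfolding e_def by blast
  have "S \<in> H" if S: "S \<subseteq> range e" "infinite S" for S
  proof -
    \<comment> \<open>The run for \<open>S\<close> extends its position at the indices in
      \<open>K\<close> and waits at all others, using that the sets \<open>Q n\<close>
      increase.\<close>
    define K where "K = {k. e k \<in> S}"
    have eK: "e ` K = S" using S(1) by (auto simp: K_def)
    then have K: "infinite K" using S(2) by auto
    define k where "k = enumerate K"
    have "\<exists>L. \<forall>j. (L j \<in> Q (k j) \<and> (j = 0 \<longrightarrow> L j = [])) \<and>
      (\<exists>D. L (Suc j) = L j @ [D] \<and> Inf D = e (k j))"
    proof (rule dependent_nat_choice)
      show "\<exists>L. L \<in> Q (k 0) \<and> (0 = (0::nat) \<longrightarrow> L = [])"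
        using Q_mono[of 0 "k 0"] Q(3) by auto
      fix L j assume "L \<in> Q (k j) \<and> (j = 0 \<longrightarrow> L = [])"
      then obtain D where D: "L @ [D] \<in> Q (Suc (k j))" "Inf D = e (k j)" using ext by blast
      have "Suc (k j) \<le> k (Suc j)"
        using enumerate_step[OF K] by (simp add: k_def Suc_le_eq)
      from Q_mono[OF this] D
      show "\<exists>M. (M \<in> Q (k (Suc j)) \<and> (Suc j = 0 \<longrightarrow> M = [])) \<and> (\<exists>D. M = L @ [D] \<and> Inf D = e (k j))"
        by auto
    qed
    then obtain L where L: "\<And>j. L j \<in> Q (k j)" "L 0 = []"
      "\<And>j. \<exists>D. L (Suc j) = L j @ [D] \<and> Inf D = e (k j)" by blast
    obtain X where X: "\<And>j. L j = map X [0..<j]" "\<And>j. Inf (X j) = e (k j)"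
      using legal_branch[of L "\<lambda>j _ D. Inf D = e (k j)", OF L(2,3)] by blast
    have leg: "legal \<sigma> (map X [0..<j])" for j
      using Q(1)[OF L(1)] X(1) by metis
    have "X j - rest (X j) = {e (k j)}" for j
      using leg[of "Suc j"] X(2)[of j] Diff_rest[OF nonempty_mem] by simp
    then have "(\<Union>j. X j - rest (X j)) = e ` range k" by auto
    also have "\<dots> = S" unfolding k_def range_enumerate[OF K] by (rule eK)
    finally show ?thesis using wins[OF leg] by simp
  qed
  moreover have "range e \<subseteq> A" using e_in C_anti C(3) by blast
  moreover have "infinite (range e)"
    using range_inj_infinite[OF strict_mono_imp_inj_on[OF e_mono]] .
  ultimately show ?thesis by blast
qed

text \<open>At stage \<open>n\<close> every stored position is extended by a move that II answers
  with minimum \<open>n\<close>, unless it is dead. The first diagonalization makes these choices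
  cohere below one \<open>B\<close>. For a stored position, the numbers by which it cannot be
  extended form a set outside \<open>H\<close>, and a second diagonalization avoids them for all
  positions together. The set obtained lies in \<open>H\<close> and is the outcome of a run
  following \<open>\<tau>\<close>, contradicting \<open>wins\<close>.\<close>

lemma no_winning_II:
  fixes \<tau> :: "nat set list \<Rightarrow> nat set" and A :: "nat set"
  defines "R \<equiv> \<lambda>L. if L = [] then A else rest (\<tau> L)"
  assumes A: "A \<in> H"
    and legal_II: "\<And>L D. legal R (L @ [D]) \<Longrightarrow> \<tau> (L @ [D]) \<in> H \<and> \<tau> (L @ [D]) \<subseteq> D"
    and wins: "\<And>X. (\<And>k. legal R (map X [0..<k])) \<Longrightarrow>
      (\<Union>k. \<tau> (map X [0..<Suc k]) - rest (\<tau> (map X [0..<Suc k]))) \<notin> H"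
  shows False
proof -
  have R_snoc: "R (L @ [D]) = rest (\<tau> (L @ [D]))" for L D by (simp add: R_def)
  define inv where "inv Q E \<longleftrightarrow> finite Q \<and> (\<forall>L\<in>Q. legal R L \<and> E \<subseteq> R L)" for Q E
  define ok where "ok n L D \<longleftrightarrow> D \<in> H \<and> D \<subseteq> R L \<and> Inf (\<tau> (L @ [D])) = n" for n L D
  \<comment> \<open>Deadness means that \<open>F\<close> is incompatible in \<open>H\<close> with
    what remains after any legal move answered with minimum \<open>n\<close>. If it fails, some such
    move can be fixed on shrinking \<open>F\<close>.\<close>
  define dead where "dead n L F \<longleftrightarrow> (\<forall>D. ok n L D \<longrightarrow> (\<forall>G\<in>H. G \<subseteq> F \<longrightarrow> \<not> G \<subseteq> R (L @ [D])))" for n L F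
  define trans where "trans n Q Q' F \<longleftrightarrow> Q \<subseteq> Q' \<and>
    (\<forall>L\<in>Q. (\<exists>D. L @ [D] \<in> Q' \<and> Inf (\<tau> (L @ [D])) = n) \<or> dead n L F)" for n Q Q' F
  have init: "inv {[]} A" by (simp add: inv_def R_def)
  have down: "inv Q F" if "inv Q E" "F \<subseteq> E" for Q E F
    using that unfolding inv_def by blast
  have down_dead: "dead n L G" if "dead n L F" "G \<subseteq> F" for n L F G
    using that unfolding dead_def by (meson subset_trans)
  have down_trans: "trans n Q Q' F" if "trans n Q Q' E" "F \<subseteq> E" for n Q Q' E F
    using that down_dead unfolding trans_def by blast
  have step: "\<exists>F\<in>H. F \<subseteq> E \<and> (\<exists>Q'. trans n Q Q' F \<and> inv Q' F)" if E: "E \<in> H" and Q: "inv Q E" for n Q E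
  proof -
    define T where "T L F \<longleftrightarrow> (\<exists>D. ok n L D \<and> F \<subseteq> R (L @ [D])) \<or> dead n L F" for L F
    have "\<exists>F\<in>H. F \<subseteq> E \<and> (\<forall>L\<in>Q. T L F)"
    proof (rule finite_tasks[OF _ E])
      show "finite Q" using Q by (simp add: inv_def)
      show "T L G" if "T L F" "G \<subseteq> F" for L F G
        using that down_dead unfolding T_def by (meson subset_trans)
      show "\<exists>G\<in>H. G \<subseteq> F \<and> T L G" if "F \<in> H" for L F
      proof (cases "dead n L F")
        case True
        then show ?thesis using that unfolding T_def by blast
      next
        case False
        then obtain D G where "ok n L D" "G \<in> H" "G \<subseteq> F" "G \<subseteq> R (L @ [D])"
          unfolding dead_def by blast
        then show ?thesis unfolding T_def by blast
      qed
    qed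
    then obtain F where F: "F \<in> H" "F \<subseteq> E" "\<forall>L\<in>Q. T L F" by (elim bexE conjE) (rule that)
    have "\<forall>L\<in>Q. \<exists>D. ok n L D \<and> F \<subseteq> R (L @ [D]) \<or> dead n L F"
      using F(3) unfolding T_def by blast
    from bchoice[OF this] obtain d where
      d: "\<forall>L\<in>Q. ok n L (d L) \<and> F \<subseteq> R (L @ [d L]) \<or> dead n L F" by blast
    define Q' where "Q' = Q \<union> (\<lambda>L. L @ [d L]) ` {L\<in>Q. ok n L (d L) \<and> F \<subseteq> R (L @ [d L])}"
    have "inv Q' F"
      using Q F(2) unfolding inv_def Q'_def ok_def by auto
    moreover have "trans n Q Q' F"
      using d unfolding trans_def Q'_def ok_def by blast
    ultimately show ?thesis using F by blast
  qed
  have "\<exists>B Q. B \<in> H \<and> B \<subseteq> A \<and> Q 0 = {[]} \<and>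
    (\<forall>n. \<exists>E\<in>H. trans n (Q n) (Q (Suc n)) E \<and> inv (Q (Suc n)) E \<and>
      (n \<in> B \<longrightarrow> {m\<in>B. m > n} \<subseteq> E))"
    by (rule dependent_diagonalization[OF A init down step down_trans])
  then obtain B Q where B: "B \<in> H" "B \<subseteq> A" and Q0: "Q 0 = {[]}"
    and Q: "\<And>n. \<exists>E\<in>H. trans n (Q n) (Q (Suc n)) E \<and> inv (Q (Suc n)) E \<and>
      (n \<in> B \<longrightarrow> {m\<in>B. m > n} \<subseteq> E)"
    by (elim exE conjE) (erule (2) that, erule spec)
  have Q_Suc: "Q n \<subseteq> Q (Suc n)" for n using Q[of n] unfolding trans_def by blast
  have Q_mono: "Q m \<subseteq> Q n" if "m \<le> n" for m n
    using Q_Suc that by (rule lift_Suc_mono_le)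
  have Q_legal: "finite (Q n)" "L \<in> Q n \<Longrightarrow> legal R L" for n L
    using Q[of n] Q_Suc[of n] unfolding inv_def by (auto intro: finite_subset)
  define follow where "follow L m \<longleftrightarrow> (\<exists>D. L @ [D] \<in> Q (Suc m) \<and> Inf (\<tau> (L @ [D])) = m)" for L m
  text \<open>Were the set of bad continuations in \<open>H\<close>, player I could play it, and II's answer would refute deadness.\<close>
  have bad: "{m\<in>S. \<not> follow L m} \<notin> H"
    if S: "S \<subseteq> B" "S \<subseteq> R L" "\<And>m. m \<in> S \<Longrightarrow> L \<in> Q m" and L: "legal R L" for L S
  proof
    define D where "D = {m\<in>S. \<not> follow L m}"
    assume "{m\<in>S. \<not> follow L m} \<in> H"
    then have D: "D \<in> H" by (simp add: D_def)
    have DR: "D \<subseteq> R L" using S(2) by (auto simp: D_def)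
    define C where "C = \<tau> (L @ [D])"
    have C: "C \<in> H" "C \<subseteq> D" using legal_II[of L D] L D DR by (auto simp: C_def)
    define m where "m = Inf C"
    have m: "m \<in> D" using C Inf_nat_def1[OF nonempty_mem[OF C(1)]] by (auto simp: m_def)
    then have m': "m \<in> B" "L \<in> Q m" "\<not> follow L m" using S by (auto simp: D_def)
    obtain E where E: "trans m (Q m) (Q (Suc m)) E" "{i\<in>B. i > m} \<subseteq> E" using Q[of m] m'(1) by blast
    then have "dead m L E" using m'(2,3) unfolding trans_def follow_def by blast
    moreover have "ok m L D" using D DR by (auto simp: ok_def m_def C_def)
    moreover have "rest C \<subseteq> E"
      using E(2) C(2) S(1) Inf_less_rest[of _ C] unfolding m_def D_def by (fastforce simp: rest_def)
    moreover have "rest C \<subseteq> R (L @ [D])" by (simp add: R_snoc C_def)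
    ultimately show False using rest_mem[OF C(1)] unfolding dead_def by blast
  qed
  define B0 where "B0 = {m\<in>B. follow [] m}"
  have "{m\<in>B. \<not> follow [] m} \<notin> H"
    by (rule bad) (use B(2) Q0 Q_mono[of 0] in \<open>auto simp: R_def\<close>)
  from coideal_Diff[OF coideal B(1) this] have B0: "B0 \<in> H"
    by (rule mono) (auto simp: B0_def)
  \<comment> \<open>All bad continuations of the finitely many positions stored after stage
    \<open>n\<close>; a finite union keeps them outside \<open>H\<close>.\<close>
  define N where "N n = (\<Union>L\<in>Q (Suc n). {m\<in>{m\<in>B. m > n}. \<not> follow L m})" for n
  have N: "N n \<notin> H" if n: "n \<in> B" for n
    unfolding N_def
  proof (rule coideal_UN[OF coideal Q_legal(1)])
    fix L assume L: "L \<in> Q (Suc n)"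
    show "{m\<in>{m\<in>B. m > n}. \<not> follow L m} \<notin> H"
    proof (rule bad)
      show "{m\<in>B. m > n} \<subseteq> R L" using Q[of n] n L unfolding inv_def by blast
      show "L \<in> Q m" if "m \<in> {m\<in>B. m > n}" for m
        using L Q_mono[of "Suc n" m] that by auto
    qed (use L Q_legal in auto)
  qed
  \<comment> \<open>\<open>N n\<close> is known to lie outside \<open>H\<close> only for
    \<open>n \<in> B\<close>; the guard keeps density true for other \<open>n\<close>.\<close>
  define D where "D n = {E\<in>H. n \<in> B \<longrightarrow> E \<inter> N n = {}}" for n
  have "\<exists>C\<in>H. C \<subseteq> B0 \<and> (\<forall>n\<in>C. {m\<in>C. m > n} \<in> D n)"
  proof (rule diagonalize_below[OF B0])
    show "\<exists>F\<in>D n. F \<subseteq> E" if "E \<in> H" for n E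
    proof (cases "n \<in> B")
      case True
      then show ?thesis using coideal_Diff[OF coideal that N]
        by (intro bexI[of _ "E - N n"]) (auto simp: D_def)
    qed (use that in \<open>auto simp: D_def\<close>)
  qed (auto simp: D_def)
  then obtain C where C: "C \<in> H" "C \<subseteq> B0" "\<forall>n\<in>C. {m\<in>C. m > n} \<in> D n"
    by (elim bexE conjE) (rule that)
  have CB: "C \<subseteq> B" using C(2) by (auto simp: B0_def)
  have follow: "follow L m" if "n \<in> C" "m \<in> C" "n < m" "L \<in> Q (Suc n)" for L n m
  proof -
    have "m \<notin> N n" using C(3) that CB unfolding D_def by blast
    then show ?thesis using that CB unfolding N_def by blast
  qed
  define c where "c = enumerate C"
  note inf = infinite_mem[OF C(1)]
  have c: "c j \<in> C" "c j < c (Suc j)" for j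
    unfolding c_def using inf enumerate_in_set enumerate_step by auto
  \<comment> \<open>The empty position is continued by \<open>B0\<close>; each later one is stored
    just after the preceding element of \<open>C\<close>, so it can be continued by the next
    element.\<close>
  have "\<exists>L. \<forall>j. ((j = 0 \<longrightarrow> L j = []) \<and> (0 < j \<longrightarrow> L j \<in> Q (Suc (c (j - 1))))) \<and>
    (\<exists>D. L (Suc j) = L j @ [D] \<and> Inf (\<tau> (L j @ [D])) = c j)"
  proof (rule dependent_nat_choice)
    fix L j assume L: "(j = 0 \<longrightarrow> L = []) \<and> (0 < j \<longrightarrow> L \<in> Q (Suc (c (j - 1))))"
    have "follow L (c j)"
    proof (cases j)
      case 0
      then show ?thesis using c(1)[of 0] C(2) L by (auto simp: B0_def)
    next
      case (Suc i)
      then show ?thesis using follow[OF c(1)[of i] c(1)[of j]] c(2)[of i] L by simp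
    qed
    then show "\<exists>M. ((Suc j = 0 \<longrightarrow> M = []) \<and> (0 < Suc j \<longrightarrow> M \<in> Q (Suc (c (Suc j - 1))))) \<and>
        (\<exists>D. M = L @ [D] \<and> Inf (\<tau> (L @ [D])) = c j)"
      unfolding follow_def by auto
  qed simp
  then obtain L where L: "L 0 = []" "\<And>j. 0 < j \<Longrightarrow> L j \<in> Q (Suc (c (j - 1)))"
    "\<And>j. \<exists>D. L (Suc j) = L j @ [D] \<and> Inf (\<tau> (L j @ [D])) = c j" by blast
  obtain X where X: "\<And>j. L j = map X [0..<j]" "\<And>j. Inf (\<tau> (map X [0..<j] @ [X j])) = c j"
    using legal_branch[of L "\<lambda>j L D. Inf (\<tau> (L @ [D])) = c j", OF L(1,3)] by blast
  have leg: "legal R (map X [0..<j])" for j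
  proof (cases j)
    case (Suc i)
    then show ?thesis using Q_legal(2)[OF L(2)[of j]] X(1)[of j] by simp
  qed simp
  have "\<tau> (map X [0..<Suc j]) - rest (\<tau> (map X [0..<Suc j])) = {c j}" for j
    using legal_II[of "map X [0..<j]" "X j"] leg[of "Suc j"] X(2)[of j] Diff_rest[OF nonempty_mem] by simp
  then have "(\<Union>j. \<tau> (map X [0..<Suc j]) - rest (\<tau> (map X [0..<Suc j]))) = range c" by auto
  also have "\<dots> = C" unfolding c_def by (rule range_enumerate[OF inf])
  finally show False using wins[OF leg] C(1) by simp
qed

end

subsection \<open>The Kastanas game\<close>

text \<open>The opponent's moves are coded by a right inverse of \<open>d\<close>, and
  \<open>pos\<close> rebuilds the full position from them and the given strategy. So the new
  strategies read the opponent's moves only: \<open>k\<close> of them in round \<open>k\<close> for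
  I, and \<open>Suc k\<close> for II, who moves second.\<close>

lemma determined_decode:
  fixes d :: "'m \<Rightarrow> 'b"
  assumes d: "surj d"
    and det: "determined {x. V (\<lambda>k. d (x (2 * k))) (\<lambda>k. d (x (2 * k + 1)))}"
  shows "(\<exists>s. \<forall>X. V (\<lambda>k. s (map X [0..<k])) X) \<or> (\<exists>t. \<forall>X. \<not> V X (\<lambda>k. t (map X [0..<Suc k])))"
proof -
  define enc where "enc = inv d"
  have d_enc [simp]: "d (enc b) = b" for b
    unfolding enc_def using d by (rule surj_f_inv_f)
  from det consider \<sigma> where "\<And>x. follows_I \<sigma> x \<Longrightarrow> V (\<lambda>k. d (x (2 * k))) (\<lambda>k. d (x (2 * k + 1)))"
    | \<tau> where "\<And>x. follows_II \<tau> x \<Longrightarrow> \<not> V (\<lambda>k. d (x (2 * k))) (\<lambda>k. d (x (2 * k + 1)))"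
    unfolding determined_def by blast
  then show ?thesis
  proof cases
    case 1
    define pos where "pos = foldl (\<lambda>p C. p @ [\<sigma> p, enc C]) []"
    have "V (\<lambda>k. d (\<sigma> (pos (map X [0..<k])))) X" for X
    proof -
      define x where "x i = (if even i then \<sigma> (pos (map X [0..<i div 2])) else enc (X (i div 2)))" for i
      have "map x [0..<2 * k] = pos (map X [0..<k])" for k
        by (induction k) (simp_all add: pos_def x_def)
      then have "follows_I \<sigma> x" unfolding follows_I_def by (simp add: x_def)
      from 1[OF this] show ?thesis by (simp add: x_def)
    qed
    then show ?thesis by (intro disjI1 exI[of _ "\<lambda>L. d (\<sigma> (pos L))"]) simp
  next
    case 2
    define pos where "pos = foldl (\<lambda>p D. p @ [enc D, \<tau> (p @ [enc D])]) []"
    have "\<not> V X (\<lambda>k. d (\<tau> (pos (map X [0..<k]) @ [enc (X k)])))" for X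
    proof -
      define x where
        "x i = (if even i then enc (X (i div 2)) else \<tau> (pos (map X [0..<i div 2]) @ [enc (X (i div 2))]))" for i
      have "map x [0..<2 * k] = pos (map X [0..<k])" for k
        by (induction k) (simp_all add: pos_def x_def)
      then have "follows_II \<tau> x" unfolding follows_II_def by (simp add: x_def)
      from 2[OF this] show ?thesis by (simp add: x_def)
    qed
    then show ?thesis
      by (intro disjI2 exI[of _ "\<lambda>L. d (\<tau> (pos (butlast L) @ [enc (last L)]))"]) simp
  qed
qed

context semiselective_coideal
begin

definition kastanas_I :: "nat set \<Rightarrow> (nat \<Rightarrow> nat set) \<Rightarrow> (nat \<Rightarrow> nat set) \<Rightarrow> nat \<Rightarrow> bool" where
  "kastanas_I A a c k \<longleftrightarrow> a k \<in> H \<and> a k \<subseteq> (if k = 0 then A else rest (c (k - 1)))"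

definition kastanas_II :: "(nat \<Rightarrow> nat set) \<Rightarrow> (nat \<Rightarrow> nat set) \<Rightarrow> nat \<Rightarrow> bool" where
  "kastanas_II a c k \<longleftrightarrow> c k \<in> H \<and> c k \<subseteq> a k"

text \<open>
  I wins iff II is the first to break a rule, or nobody does and the outcome is in \<open>H\<close>: for I's obligation
  at \<open>k\<close> it suffices to look at II's earlier moves, as I's earlier obligations then apply as well.
\<close>

definition kastanas :: "nat set \<Rightarrow> (nat \<Rightarrow> nat set) \<Rightarrow> (nat \<Rightarrow> nat set) \<Rightarrow> bool" where
  "kastanas A a c \<longleftrightarrow>
     (\<forall>k. (\<forall>j<k. kastanas_II a c j) \<longrightarrow> kastanas_I A a c k) \<and>
     ((\<forall>k. kastanas_II a c k) \<longrightarrow> (\<Union>k. c k - rest (c k)) \<in> H)"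

text \<open>Membership in \<open>H\<close> is the only ingredient that need not be Borel, and all
  quantifiers range over natural numbers. Finitely many levels above that of \<open>H\<close>
  therefore suffice.\<close>

lemma projective_kastanas:
  assumes "projective_family H"
  shows "projective {x. kastanas A (\<lambda>k. decode (x (2 * k))) (\<lambda>k. decode (x (2 * k + 1)))}"
proof -
  define a :: "(nat \<Rightarrow> real) \<Rightarrow> nat \<Rightarrow> nat set" where "a x k = decode (x (2 * k))" for x k
  define c :: "(nat \<Rightarrow> real) \<Rightarrow> nat \<Rightarrow> nat set" where "c x k = decode (x (2 * k + 1))" for x k
  obtain n where n: "\<And>F :: (nat \<Rightarrow> real) \<Rightarrow> nat set.
      (\<And>m. Measurable.pred borel (\<lambda>x. m \<in> F x)) \<Longrightarrow> Sigma1_pred n (\<lambda>x. F x \<in> H)"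
    using Sigma1_pred_mem_family[OF assms] by blast
  have a [measurable]: "Measurable.pred borel (\<lambda>x. m \<in> a x k)"
    and c [measurable]: "Measurable.pred borel (\<lambda>x. m \<in> c x k)" for m k
    unfolding a_def c_def by (rule pred_mem_decode)+
  have r: "m \<in> rest (c x k) \<longleftrightarrow> m \<in> c x k \<and> (\<exists>j. j \<in> c x k \<and> j < m)" for m x k
    by (auto simp: rest_def)
  have r_meas [measurable]: "Measurable.pred borel (\<lambda>x. m \<in> rest (c x k))" for m k
    unfolding r by measurable
  have "Measurable.pred borel (\<lambda>x. a x k \<subseteq> (if k = 0 then A else rest (c x (k - 1))))" for k
    unfolding subset_eq Ball_def by (cases "k = 0") simp_all
  from Sigma1_pred_conj[OF n[OF a] Sigma1_pred_borel[OF this]]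
  have I: "Sigma1_pred (n + 2) (\<lambda>x. kastanas_I A (a x) (c x) k)" for k
    unfolding kastanas_I_def .
  have "Measurable.pred borel (\<lambda>x. c x k \<subseteq> a x k)" for k
    unfolding subset_eq Ball_def by measurable
  from Sigma1_pred_conj[OF n[OF c] Sigma1_pred_borel[OF this]]
  have II: "Sigma1_pred (n + 2) (\<lambda>x. kastanas_II (a x) (c x) k)" for k
    unfolding kastanas_II_def .
  have "Sigma1_pred (n + 2) (\<lambda>x. j < k \<longrightarrow> kastanas_II (a x) (c x) j)" for j k
    using II[of j] by (cases "j < k") (simp_all add: Sigma1_pred_borel)
  then have "Sigma1_pred (n + 2 + 2) (\<lambda>x. \<forall>j<k. kastanas_II (a x) (c x) j)" for k
    by (rule Sigma1_pred_all)
  from Sigma1_pred_imp[OF this Sigma1_pred_mono[OF I]]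
  have 1: "Sigma1_pred (n + 2 + 2 + 4 + 2)
      (\<lambda>x. \<forall>k. (\<forall>j<k. kastanas_II (a x) (c x) j) \<longrightarrow> kastanas_I A (a x) (c x) k)"
    by (intro Sigma1_pred_all) simp
  have "Measurable.pred borel (\<lambda>x. m \<in> (\<Union>k. c x k - rest (c x k)))" for m
    unfolding UN_iff Diff_iff Bex_def by measurable
  from Sigma1_pred_mono[OF n[OF this]] Sigma1_pred_all[OF II]
  have "Sigma1_pred (n + 2 + 2 + 4)
      (\<lambda>x. (\<forall>k. kastanas_II (a x) (c x) k) \<longrightarrow> (\<Union>k. c x k - rest (c x k)) \<in> H)"
    by (intro Sigma1_pred_imp) simp_all
  from Sigma1_pred_conj[OF 1 Sigma1_pred_mono[OF this]]
  have "Sigma1_pred (n + 2 + 2 + 4 + 2 + 2) (\<lambda>x. kastanas A (a x) (c x))"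
    unfolding kastanas_def by simp
  then show ?thesis
    unfolding projective_def Sigma1_pred_def a_def c_def by blast
qed

section \<open>From the payoff of the game to strategies that obey the rules\<close>

lemma legal_map: "legal g (map X [0..<k]) \<longleftrightarrow> (\<forall>j<k. X j \<in> H \<and> X j \<subseteq> g (map X [0..<j]))"
  by (auto simp: legal_def take_map)

lemma list_as_map:
  obtains X where "L = map X [0..<length L]"
  using map_nth[of L] by metis

text \<open>A winning strategy obeys the rules as long as II does: continue II's legal moves to an
  infinite sequence and read I's obligation at the next round off the payoff.\<close>

lemma kastanas_I_imp:
  assumes s: "\<And>X. kastanas A (\<lambda>k. s (map X [0..<k])) X"
  shows "\<exists>B. B \<subseteq> A \<and> infinite B \<and> (\<forall>C. C \<subseteq> B \<and> infinite C \<longrightarrow> C \<in> H)"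
proof (rule winning_I_imp[of s])
  fix L assume L: "legal s L"
  define n where "n = length L"
  obtain X where X: "L = map X [0..<n]"
    unfolding n_def by (rule list_as_map)
  have "kastanas_I A (\<lambda>k. s (map X [0..<k])) X n"
    using s[of X] L unfolding X legal_map kastanas_def kastanas_II_def by blast
  then show "s L \<in> H \<and> s L \<subseteq> (if L = [] then A else rest (last L))"
    by (cases n) (simp_all add: kastanas_I_def X)
next
  fix X assume "\<And>k. legal s (map X [0..<k])"
  then have "kastanas_II (\<lambda>k. s (map X [0..<k])) X k" for k
    unfolding legal_map kastanas_II_def by blast
  then show "(\<Union>k. X k - rest (X k)) \<in> H"
    using s[of X] unfolding kastanas_def by blast
qed

lemma kastanas_II_imp:
  assumes A: "A \<in> H" and t: "\<And>X. \<not> kastanas A X (\<lambda>k. t (map X [0..<Suc k]))"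
  shows False
proof (rule no_winning_II[of A t, OF A])
  let ?R = "\<lambda>L. if L = [] then A else rest (t L)"
  have I: "kastanas_I A X (\<lambda>k. t (map X [0..<Suc k])) k" if "legal ?R (map X [0..<Suc k])" for X k
  proof -
    have "X k \<in> H \<and> X k \<subseteq> ?R (map X [0..<k])"
      using that unfolding legal_map by blast
    then show ?thesis by (cases k) (simp_all add: kastanas_I_def)
  qed
  have leg: "legal g (map X [0..<j])" if "legal g (map X [0..<k])" "j \<le> k" for g X j k
    using that unfolding legal_map by auto
  show "t (L @ [D]) \<in> H \<and> t (L @ [D]) \<subseteq> D" if L: "legal ?R (L @ [D])" for L D
  proof -
    define n where "n = length L"
    obtain X where "L @ [D] = map X [0..<length (L @ [D])]" by (rule list_as_map)
    then have X: "L @ [D] = map X [0..<Suc n]" by (simp add: n_def)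
    then have D: "D = X n" by simp
    have "kastanas_I A X (\<lambda>k. t (map X [0..<Suc k])) k" if "k \<le> n" for k
      using I leg[OF L[unfolded X], of "Suc k"] that by simp
    moreover have "n < k" if "\<not> k \<le> n" for k using that by simp
    \<comment> \<open>I loses either by breaking a rule in a round after \<open>n\<close> with II
      correct in all earlier rounds, or by the outcome with II correct throughout. Either way II is
      correct in round \<open>n\<close>.\<close>
    ultimately have "kastanas_II X (\<lambda>k. t (map X [0..<Suc k])) n"
      using t[of X] unfolding kastanas_def by blast
    then show ?thesis unfolding kastanas_II_def X[symmetric] D[symmetric] .
  qed
  show "(\<Union>k. t (map X [0..<Suc k]) - rest (t (map X [0..<Suc k]))) \<notin> H"
    if "\<And>k. legal ?R (map X [0..<k])" for X
    using t[of X] I[OF that] unfolding kastanas_def by blast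
qed

end

theorem theorem5p5:
  fixes H :: "nat set set"
  assumes "projective_determinacy_reals"
    and "coideal H" and "projective_family H" and "semiselective H"
  shows "frechet_urysohn H"
proof -
  interpret semiselective_coideal H
    by (unfold_locales) (fact assms)+
  have "\<exists>B. B \<subseteq> A \<and> infinite B \<and> (\<forall>C. C \<subseteq> B \<and> infinite C \<longrightarrow> C \<in> H)" if A: "A \<in> H" for A
  proof -
    have "determined {x. kastanas A (\<lambda>k. decode (x (2 * k))) (\<lambda>k. decode (x (2 * k + 1)))}"
      using assms(1) projective_kastanas[OF assms(3)]
      unfolding projective_determinacy_reals_def by blast
    from determined_decode[OF surj_decode this] show ?thesis
      using kastanas_I_imp kastanas_II_imp[OF A] by blast
  qed
  then show ?thesis unfolding frechet_urysohn_def by blast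
qed

end
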